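(* For every integer $t\geq 5$, there is a (finite, simple) graph $G_t$ with $E(G_t)\neq \varnothing$ such that $G_t$ is $C_{2t-2}$-free, but for every edge $e\in E(G_t)$ the graph $G_t-e$ (obtained from $G_t$ by removing the edge $e$) has an induced subgraph isomorphic to $C_{2t-2}$.
   Context: Graphs are finite, without loops or parallel edges. $C_k$ denotes the cycle on $k$ vertices. A graph $G$ is $H$-free if no induced subgraph of $G$ is isomorphic to $H$. *)

theory Defs
  imports Main
begin

text \<open>A graph is a pair of a vertex set and a set of edges, an edge being the two-element set of its
  end vertices; hence there are no loops and no parallel edges.\<close>

type_synonym 'a graph = "'a set \<times> 'a set set"

abbreviation verts :: "'a graph \<Rightarrow> 'a set" where
  "verts G \<equiv> fst G"

abbreviation edges :: "'a graph \<Rightarrow> 'a set set" where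
  "edges G \<equiv> snd G"

definition finite_simple_graph :: "'a graph \<Rightarrow> bool" where
  "finite_simple_graph G \<longleftrightarrow>
     finite (verts G) \<and> (\<forall>e\<in>edges G. e \<subseteq> verts G \<and> card e = 2)"

definition graph_isomorphic :: "'a graph \<Rightarrow> 'b graph \<Rightarrow> bool" where
  "graph_isomorphic G H \<longleftrightarrow>
     (\<exists>f. bij_betw f (verts G) (verts H) \<and>
          (\<forall>u\<in>verts G. \<forall>v\<in>verts G. {u, v} \<in> edges G \<longleftrightarrow> {f u, f v} \<in> edges H))"

definition induced_subgraph :: "'a graph \<Rightarrow> 'a set \<Rightarrow> 'a graph" where
  "induced_subgraph G S = (S, {e \<in> edges G. e \<subseteq> S})"

definition has_induced :: "'a graph \<Rightarrow> 'b graph \<Rightarrow> bool" where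
  "has_induced G H \<longleftrightarrow>
     (\<exists>S. S \<subseteq> verts G \<and> graph_isomorphic (induced_subgraph G S) H)"

definition induced_free :: "'b graph \<Rightarrow> 'a graph \<Rightarrow> bool" where
  "induced_free H G \<longleftrightarrow> \<not> has_induced G H"

definition delete_edge :: "'a graph \<Rightarrow> 'a set \<Rightarrow> 'a graph" where
  "delete_edge G e = (verts G, edges G - {e})"

text \<open>This is the cycle on \<open>k\<close> vertices only for \<open>k \<ge> 3\<close>.\<close>

definition cycle_graph :: "nat \<Rightarrow> nat graph" where
  "cycle_graph k = ({..<k}, {{i, (i + 1) mod k} | i. i < k})"

end

theory Submission
  imports Defs
begin

text \<open>
  Let \<open>k = 2t - 2 = m + 4a\<close> with \<open>m \<in> {2, 4}\<close>, and let \<open>n = 2m + 7a\<close>. The graph is the circulant on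
  the integers modulo \<open>n\<close> in which \<open>x\<close> and \<open>y\<close> are adjacent iff \<open>y - x\<close> is \<open>2\<close>, \<open>3\<close>, \<open>-2\<close> or \<open>-3\<close>.
  Walk along an induced \<open>k\<close>-cycle. Since sums of two, three or four consecutive steps are neither
  zero nor steps themselves, the walk, suitably oriented, only uses the steps \<open>2\<close>, \<open>3\<close> and \<open>-2\<close>, and
  every \<open>-2\<close> sits in a block \<open>3, -2, 3, 3\<close> of its own, preceded by a further \<open>3\<close>. The steps then sum to
  exactly \<open>n\<close>, and counting leaves only \<open>a\<close> blocks together with \<open>m\<close> steps \<open>2\<close>; but some step \<open>2\<close> would
  have to precede a block. With one chord allowed the count is attained: the closed walk
  \<open>(3, -2, 3, 3)\<^sup>a 2\<^sup>m\<close> has a single chord, of difference \<open>3\<close>, and for \<open>a \<ge> 2\<close> the closed walk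
  \<open>(3, -2, 3, 3)\<^bsup>a-2\<^esup> (3, -2, 3) (3, -2, 3, 3) 2\<^sup>m 3\<close> has a single chord, of difference \<open>2\<close>.
\<close>

section \<open>The circulant graph and adjacency modulo \<open>n\<close>\<close>

definition close_mod :: "int \<Rightarrow> int \<Rightarrow> bool" where
  "close_mod n z \<longleftrightarrow> (\<exists>s\<in>{2, 3, -2, -3}. n dvd z - s)"

definition circulant23 :: "nat \<Rightarrow> nat graph" where
  "circulant23 n =
     ({..<n}, {{x, y} | x y. x < n \<and> y < n \<and> close_mod (int n) (int y - int x)})"

lemma close_mod_uminus: "close_mod n (- z) \<longleftrightarrow> close_mod n z"
proof -
  have "close_mod n (- z)" if "close_mod n z" for z
  proof -
    from that obtain s where s: "s \<in> {2, 3, -2, -3}" "n dvd z - s"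
      unfolding close_mod_def by blast
    have "n dvd - z - (- s)" using s(2) dvd_minus_iff[of n "z - s"] by simp
    moreover have "- s \<in> {2, 3, -2, -3}" using s(1) by auto
    ultimately show ?thesis unfolding close_mod_def by blast
  qed
  from this[of z] this[of "- z"] show ?thesis by auto
qed

lemma close_mod_cong:
  assumes "n dvd z - w"
  shows "close_mod n z \<longleftrightarrow> close_mod n w"
proof -
  have "n dvd z - s \<longleftrightarrow> n dvd w - s" for s
    using dvd_add_right_iff[OF assms, of "w - s"] by simp
  then show ?thesis unfolding close_mod_def by blast
qed

lemma not_dvd_small: "\<not> n dvd z" if "z \<noteq> 0" "\<bar>z\<bar> < n" for n z :: int
  using that zdvd_not_zless[of "\<bar>z\<bar>" n] by auto

text \<open>Since \<open>z - s\<close> has absolute value below \<open>2 * n\<close>, the quotient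
  can only be -1, 0 or 1. This turns adjacency into a test on the integer difference of two
  positions in one period.\<close>

lemma close_mod_iff:
  assumes "\<bar>z\<bar> < n" "n > 6"
  shows "close_mod n z \<longleftrightarrow> \<bar>z\<bar> \<in> {2, 3, n - 2, n - 3}"
proof
  assume "close_mod n z"
  then obtain s q where s: "s \<in> {2, 3, -2, -3}" and q: "z - s = n * q"
    unfolding close_mod_def by blast
  have "\<bar>n * q\<bar> < n * 2" using q s assms by auto
  then have "\<bar>q\<bar> < 2" using assms by (simp add: abs_mult)
  then have "q = -1 \<or> q = 0 \<or> q = 1" by linarith
  then show "\<bar>z\<bar> \<in> {2, 3, n - 2, n - 3}" using q s assms by auto
next
  assume "\<bar>z\<bar> \<in> {2, 3, n - 2, n - 3}"
  then consider "z \<in> {2, 3, -2, -3}" | "z = n - 2" | "z = n - 3" | "z = 2 - n" | "z = 3 - n"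
    by (auto simp: abs_if split: if_splits)
  then show "close_mod n z"
    unfolding close_mod_def
    by cases auto
qed

lemma not_close_mod_zero: "n > 6 \<Longrightarrow> \<not> close_mod n 0"
  using close_mod_iff[of 0 n] by auto

lemma verts_circulant23 [simp]: "verts (circulant23 n) = {..<n}"
  by (simp add: circulant23_def)

lemma edges_circulant23_iff:
  "{x, y} \<in> edges (circulant23 n) \<longleftrightarrow> x < n \<and> y < n \<and> close_mod (int n) (int y - int x)"
  unfolding circulant23_def
  using close_mod_uminus[of "int n" "int y - int x"]
  by (auto simp: doubleton_eq_iff)

lemma finite_simple_circulant23:
  assumes "n > 6"
  shows "finite_simple_graph (circulant23 n)"
proof -
  have "x \<noteq> y" if "close_mod (int n) (int y - int x)" for x y
    using that not_close_mod_zero[of "int n"] assms by auto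
  then show ?thesis
    unfolding finite_simple_graph_def by (fastforce simp: circulant23_def card_2_iff)
qed

section \<open>Induced cycles as indexed embeddings\<close>

lemma cycle_graph_edge_iff:
  assumes "i < k" "j < k"
  shows "{i, j} \<in> edges (cycle_graph k) \<longleftrightarrow> j = (i + 1) mod k \<or> i = (j + 1) mod k"
  using assms unfolding cycle_graph_def by (auto simp: doubleton_eq_iff)

text \<open>The isomorphism in the definition runs from the subgraph to the cycle. Inverting it
  gives a map from indices to vertices, which suits walks better.\<close>

lemma has_inducedI:
  assumes "inj_on f {..<k}" "f ` {..<k} \<subseteq> verts G"
    and "\<And>i j. \<lbrakk>i < k; j < k\<rbrakk> \<Longrightarrow>
           {f i, f j} \<in> edges G \<longleftrightarrow> {i, j} \<in> edges (cycle_graph k)"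
  shows "has_induced G (cycle_graph k)"
proof -
  define g where "g = inv_into {..<k} f"
  have bij: "bij_betw g (f ` {..<k}) {..<k}"
    unfolding g_def using assms(1) by (simp add: bij_betw_inv_into inj_on_imp_bij_betw)
  have gf: "g (f i) = i" if "i < k" for i
    using that assms(1) by (simp add: g_def)
  show ?thesis
    unfolding has_induced_def graph_isomorphic_def
  proof (intro exI[of _ "f ` {..<k}"] conjI exI[of _ g])
    show "bij_betw g (verts (induced_subgraph G (f ` {..<k}))) (verts (cycle_graph k))"
      using bij by (simp add: induced_subgraph_def cycle_graph_def)
  qed (use assms gf in \<open>auto simp: induced_subgraph_def\<close>)
qed

lemma has_inducedE:
  assumes "has_induced G (cycle_graph k)"
  obtains f where "inj_on f {..<k}" "f ` {..<k} \<subseteq> verts G"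
    "\<And>i j. \<lbrakk>i < k; j < k\<rbrakk> \<Longrightarrow>
       {f i, f j} \<in> edges G \<longleftrightarrow> {i, j} \<in> edges (cycle_graph k)"
proof -
  from assms obtain S g where S: "S \<subseteq> verts G" and bij: "bij_betw g S {..<k}"
    and e: "\<And>u v. \<lbrakk>u \<in> S; v \<in> S\<rbrakk> \<Longrightarrow>
              {u, v} \<in> edges G \<longleftrightarrow> {g u, g v} \<in> edges (cycle_graph k)"
    unfolding has_induced_def graph_isomorphic_def
    by (auto simp: induced_subgraph_def cycle_graph_def)
  define f where "f = inv_into S g"
  have f: "bij_betw f {..<k} S" unfolding f_def by (rule bij_betw_inv_into[OF bij])
  have gf: "g (f i) = i" if "i < k" for i
    using that bij by (simp add: f_def bij_betw_inv_into_right)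
  have fS: "f i \<in> S" if "i < k" for i
    using that f by (auto simp: bij_betw_def)
  show thesis
  proof (rule that[of f])
    show "inj_on f {..<k}" using f by (simp add: bij_betw_def)
    show "f ` {..<k} \<subseteq> verts G" using fS S by auto
    show "{f i, f j} \<in> edges G \<longleftrightarrow> {i, j} \<in> edges (cycle_graph k)" if "i < k" "j < k" for i j
      using e[OF fS fS] gf that by simp
  qed
qed

section \<open>Steps along an induced cycle and their sum\<close>

lemma sum_periodic_shift:
  fixes g :: "nat \<Rightarrow> int"
  assumes "\<And>i. g (i + k) = g i"
  shows "(\<Sum>i<k. g (i + s)) = (\<Sum>i<k. g i)"
proof (induction s)
  case (Suc s)
  have "(\<Sum>i<k. g (i + Suc s)) + g s = (\<Sum>i<Suc k. g (i + s))"
    by (subst sum.lessThan_Suc_shift) simp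
  also have "\<dots> = (\<Sum>i<k. g (i + s)) + g s"
    using assms[of s] by (simp add: add.commute)
  finally show ?case using Suc by simp
qed simp

text \<open>A finite check on four consecutive steps. The sign of a three-step sum serves as the
  local orientation of the walk, and it cannot change from one window to the next.\<close>

lemma orientation_constant:
  fixes p q r s :: int
  assumes "p \<in> {2, 3, -2, -3}" "q \<in> {2, 3, -2, -3}" "r \<in> {2, 3, -2, -3}" "s \<in> {2, 3, -2, -3}"
    and "p + q \<notin> {0, 2, 3, -2, -3}" "q + r \<notin> {0, 2, 3, -2, -3}" "r + s \<notin> {0, 2, 3, -2, -3}"
    and "p + q + r \<notin> {0, 2, 3, -2, -3}" "q + r + s \<notin> {0, 2, 3, -2, -3}"
    and "p + q + r + s \<notin> {0, 2, 3, -2, -3}"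
  shows "(p + q + r > 0 \<longleftrightarrow> q + r + s > 0) \<and> (p + q + r > 0 \<longrightarrow> q \<noteq> -3)"
proof -
  let ?V = "{2, 3, -2, -3} :: int set" and ?X = "{0, 2, 3, -2, -3} :: int set"
  \<comment> \<open>Each constraint follows the quantifier of its last variable, so a violated one
    cuts off the enumeration below it.\<close>
  have "\<forall>p\<in>?V. \<forall>q\<in>?V. p + q \<notin> ?X \<longrightarrow> (\<forall>r\<in>?V. q + r \<notin> ?X \<longrightarrow> p + q + r \<notin> ?X \<longrightarrow>
      (\<forall>s\<in>?V. r + s \<notin> ?X \<longrightarrow> q + r + s \<notin> ?X \<longrightarrow> p + q + r + s \<notin> ?X \<longrightarrow>
        (p + q + r > 0 \<longleftrightarrow> q + r + s > 0) \<and> (p + q + r > 0 \<longrightarrow> q \<noteq> -3)))"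
    by simp
  from this[THEN bspec, OF assms(1), THEN bspec, OF assms(2), THEN mp, OF assms(5),
      THEN bspec, OF assms(3), THEN mp, OF assms(6), THEN mp, OF assms(8),
      THEN bspec, OF assms(4), THEN mp, OF assms(7), THEN mp, OF assms(9), THEN mp, OF assms(10)]
  show ?thesis .
qed

lemma orientation_window:
  fixes d :: "nat \<Rightarrow> int"
  assumes vals: "\<And>i. d i \<in> {2, 3, -2, -3}"
    and two: "\<And>i. d i + d (i + 1) \<notin> {0, 2, 3, -2, -3}"
    and three: "\<And>i. d i + d (i + 1) + d (i + 2) \<notin> {0, 2, 3, -2, -3}"
    and four: "\<And>i. d i + d (i + 1) + d (i + 2) + d (i + 3) \<notin> {0, 2, 3, -2, -3}"
  shows "(d i + d (i + 1) + d (i + 2) > 0 \<longleftrightarrow> d (i + 1) + d (i + 2) + d (i + 3) > 0) \<and>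
    (d i + d (i + 1) + d (i + 2) > 0 \<longrightarrow> d (i + 1) \<noteq> -3)"
proof -
  have idx: "i + 1 + 1 = i + 2" "i + 2 + 1 = i + 3" "i + 1 + 2 = i + 3" by simp_all
  show ?thesis
    using orientation_constant[OF vals vals vals vals two[of i] two[of "i + 1", unfolded idx]
        two[of "i + 2", unfolded idx] three[of i] three[of "i + 1", unfolded idx] four[of i]]
    by blast
qed

text \<open>With \<open>j\<close> steps equal to -2, hence \<open>j\<close> disjoint blocks, the
  total excess \<open>c\<close> lies between 0 and the number \<open>k - 4 * j\<close> of steps
  outside blocks. Divisibility then forces \<open>j = a\<close> and \<open>c = 0\<close>, so every
  step outside blocks is 2. No block can directly follow such a step, so there would be no block at
  all.\<close>

lemma step_sum_ne:
  fixes d :: "nat \<Rightarrow> int" and k a m :: nat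
  assumes per: "\<And>i. d (i + k) = d i"
    and vals: "\<And>i. d i \<in> {2, 3, -2, -3}"
    and two: "\<And>i. d i + d (i + 1) \<notin> {0, 2, 3, -2, -3}"
    and three: "\<And>i. d i + d (i + 1) + d (i + 2) \<notin> {0, 2, 3, -2, -3}"
    and four: "\<And>i. d i + d (i + 1) + d (i + 2) + d (i + 3) \<notin> {0, 2, 3, -2, -3}"
    and pos: "\<And>i. d i + d (i + 1) + d (i + 2) > 0"
    and k: "k = m + 4 * a" and m: "m = 2 \<or> m = 4" and a: "a \<ge> 1"
  shows "\<not> int (2 * m + 7 * a) dvd (\<Sum>i<k. d i)"
proof
  assume dvd: "int (2 * m + 7 * a) dvd (\<Sum>i<k. d i)"
  have two': "d (i + 1) + d (i + 2) \<notin> {0, 2, 3, -2, -3}" for i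
    using two[of "i + 1"] by simp
  have nxt: "d (i + 1) \<noteq> -3" for i
    using orientation_window[OF vals two three four, of i] pos[of i] by blast
  \<comment> \<open>\<open>nxt\<close> does not reach index 0; a shift by the period supplies its
    predecessor.\<close>
  have "d i \<noteq> -3" for i
  proof -
    have "i + k - 1 + 1 = i + k" using k m by auto
    then show ?thesis using nxt[of "i + k - 1"] per[of i] by simp
  qed
  then have vals': "d i = 2 \<or> d i = 3 \<or> d i = -2" for i
    using vals[of i] by auto
  have after: "d (i + 1) = 3" "d (i + 2) = 3" "d (i + 3) \<noteq> -2" if "d i = -2" for i
  proof -
    show 1: "d (i + 1) = 3"
      using that two[of i] pos[of i] vals'[of "i + 1"] vals'[of "i + 2"] by auto
    show 2: "d (i + 2) = 3" using that 1 three[of i] pos[of i] vals'[of "i + 2"] by auto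
    show "d (i + 3) \<noteq> -2" using that 1 2 four[of i] by auto
  qed
  have before: "d (i + 1) = 3" "d i = 3" if "d (i + 2) = -2" for i
  proof -
    show 1: "d (i + 1) = 3" using that two'[of i] pos[of i] vals'[of "i + 1"] vals'[of i] by auto
    show "d i = 3" using that 1 three[of i] pos[of i] vals'[of i] by auto
  qed
  \<comment> \<open>\<open>r\<close> indicates the steps outside all blocks; \<open>c\<close> is the excess of a step over \<open>2\<close> after the
    steps \<open>3, -2, 3, 3\<close> of each block have been levelled to \<open>2, 2, 2, 2\<close>, which adds one per block.
    Both describe the step with index \<open>i + 2\<close>.\<close>
  define b where "b i = (if d i = -2 then 1 else 0 :: int)" for i
  define r where "r i = 1 - b i - b (i + 1) - b (i + 2) - b (i + 3)" for i
  define c where "c i = d (i + 2) - 2 + 4 * b (i + 2) - b (i + 3) - b (i + 1) - b i" for i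
  have bper: "b (i + k) = b i" for i by (simp add: b_def per)
  have rc: "0 \<le> c i" "c i \<le> r i" "d (i + 2) = 2 \<or> c i = r i" for i
  proof -
    consider "d i = -2" | "d (i + 1) = -2" | "d (i + 2) = -2" | "d (i + 3) = -2"
      | "d i \<noteq> -2" "d (i + 1) \<noteq> -2" "d (i + 2) \<noteq> -2" "d (i + 3) \<noteq> -2" by blast
    then have "0 \<le> c i \<and> c i \<le> r i \<and> (d (i + 2) = 2 \<or> c i = r i)"
    proof cases
      case 1
      with after[of i] show ?thesis by (simp add: c_def r_def b_def)
    next
      case 2
      with after[of "i + 1"] after(1)[of i] have "d i \<noteq> -2" "d (i + 2) = 3" "d (i + 3) = 3"
        by (auto simp: numeral_eq_Suc)
      with 2 show ?thesis by (simp add: c_def r_def b_def)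
    next
      case 3
      with after(1)[of "i + 2"] before[of i] have "d i = 3" "d (i + 1) = 3" "d (i + 3) = 3"
        by (simp_all add: numeral_eq_Suc)
      with 3 show ?thesis by (simp add: c_def r_def b_def)
    next
      case 4
      with after(3)[of i] before[of "i + 1"] have "d i \<noteq> -2" "d (i + 1) = 3" "d (i + 2) = 3"
        by (auto simp: numeral_eq_Suc)
      with 4 show ?thesis by (simp add: c_def r_def b_def)
    next
      case 5
      with vals'[of "i + 2"] show ?thesis by (auto simp: c_def r_def b_def)
    qed
    then show "0 \<le> c i" "c i \<le> r i" "d (i + 2) = 2 \<or> c i = r i" by auto
  qed
  define j where "j = (\<Sum>i<k. b i)"
  have bs: "(\<Sum>i<k. b (i + s)) = j" for s
    unfolding j_def by (rule sum_periodic_shift) (rule bper)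
  have sr: "(\<Sum>i<k. r i) = int k - 4 * j"
    using bs[of 0] bs[of 1] bs[of 2] bs[of 3] by (simp add: r_def sum_subtractf)
  have ds: "(\<Sum>i<k. d (i + 2)) = (\<Sum>i<k. d i)" by (rule sum_periodic_shift) (rule per)
  have sc: "(\<Sum>i<k. c i) = (\<Sum>i<k. d i) - 2 * int k + j"
    using bs[of 0] bs[of 1] bs[of 2] bs[of 3] ds
    by (simp add: c_def sum_subtractf sum.distrib flip: sum_distrib_left)
  have c0: "0 \<le> (\<Sum>i<k. c i)" by (rule sum_nonneg) (use rc in auto)
  have cr: "(\<Sum>i<k. c i) \<le> (\<Sum>i<k. r i)" by (rule sum_mono) (use rc in auto)
  have "(\<Sum>i<k. d i) \<le> (\<Sum>i<k. 3)"
    by (rule sum_mono) (use vals' in \<open>smt (verit)\<close>)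
  then have ub: "(\<Sum>i<k. d i) \<le> 3 * int k" by simp
  \<comment> \<open>From \<open>0 \<le> k - 4 * j\<close> and \<open>2 * k - j \<le>\<close> the
    sum.\<close>
  have lb: "(\<Sum>i<k. d i) > 0" using sc sr c0 cr k a by linarith
  obtain w where w: "(\<Sum>i<k. d i) = int (2 * m + 7 * a) * w" using dvd by blast
  have "w > 0" using lb w by (simp add: zero_less_mult_iff)
  \<comment> \<open>Twice the modulus is \<open>4 * m + 14 * a\<close>, more than the upper bound
    \<open>3 * m + 12 * a\<close>.\<close>
  moreover have "w < 2"
  proof (rule ccontr)
    assume "\<not> w < 2"
    then have "int (2 * m + 7 * a) * 2 \<le> int (2 * m + 7 * a) * w" by (intro mult_left_mono) auto
    then show False using ub w k a by simp
  qed
  ultimately have "w = 1" by simp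
  with w have sd: "(\<Sum>i<k. d i) = 2 * int m + 7 * int a" by simp
  \<comment> \<open>The sum of \<open>c\<close> is now \<open>j - a\<close>, and that of
    \<open>r\<close> is \<open>m - 4 * (j - a)\<close>. Hence
    \<open>0 \<le> 5 * (j - a) \<le> m \<le> 4\<close>, which leaves only
    \<open>j = a\<close>.\<close>
  have sc0: "(\<Sum>i<k. c i) = 0" and ja: "j = int a"
    using sd sc sr c0 cr k m by auto
  have call: "c i = 0" if "i < k" for i
    using sc0 rc that by (subst (asm) sum_nonneg_eq_0_iff) auto
  have cper: "c (i + k) = c i" for i
    using bper[of i] bper[of "i + 1"] bper[of "i + 2"] bper[of "i + 3"] per[of "i + 2"]
    by (simp add: c_def numeral_eq_Suc)
  have cz: "c i = 0" for i
  proof (induction i rule: less_induct)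
    case (less i)
    show ?case
    proof (cases "i < k")
      case False
      then have "c i = c (i - k)" "i - k < i" using cper[of "i - k"] k m by auto
      then show ?thesis using less by simp
    qed (rule call)
  qed
  have "\<exists>i<k. r i > 0"
  proof (rule ccontr)
    assume "\<not> ?thesis"
    then have "(\<Sum>i<k. r i) \<le> 0" by (intro sum_nonpos) auto
    then show False using sr ja k m by auto
  qed
  then obtain i0 where i0: "r i0 > 0" by blast
  \<comment> \<open>A step outside blocks is 2 because \<open>c\<close> vanishes. The step two
    places before a -2 is 3, so no block begins right after, and the next step is outside blocks
    too.\<close>
  have rpos: "r (i0 + s) > 0" for s
  proof (induction s)
    case (Suc s)
    let ?i = "i0 + s"
    have d2: "d (?i + 2) = 2" using Suc rc(3)[of ?i] cz[of ?i] by auto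
    then have "d (?i + 4) \<noteq> -2" using before(2)[of "?i + 2"] by (auto simp: numeral_eq_Suc)
    then show ?case using Suc by (auto simp: r_def b_def numeral_eq_Suc split: if_splits)
  qed (use i0 in simp)
  have "b (i + i0) = 0" for i
    using rpos[of i] by (auto simp: r_def b_def add.commute split: if_splits)
  then have "j = 0" using bs[of i0] by simp
  then show False using ja a by simp
qed

text \<open>A short sum of steps equal to 0 would repeat a vertex, and one equal to a step would
  give a chord. So the steps of an induced cycle meet the local conditions of
  \<open>step_sum_ne\<close>, up to a global sign, while closing up makes their sum divisible by
  \<open>n\<close>.\<close>

lemma circulant23_induced_free:
  assumes k: "k = m + 4 * a" and m: "m = 2 \<or> m = 4" and a: "a \<ge> 1" and k8: "k \<ge> 8"
    and n: "n = 2 * m + 7 * a"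
  shows "induced_free (cycle_graph k) (circulant23 n)"
  unfolding induced_free_def
proof
  assume "has_induced (circulant23 n) (cycle_graph k)"
  then obtain f where inj: "inj_on f {..<k}" and f: "f ` {..<k} \<subseteq> {..<n}"
    and e: "\<And>i j. \<lbrakk>i < k; j < k\<rbrakk> \<Longrightarrow>
       {f i, f j} \<in> edges (circulant23 n) \<longleftrightarrow> {i, j} \<in> edges (cycle_graph k)"
    by (auto elim: has_inducedE)
  have fn: "f (i mod k) < n" for i using f k8 by (auto simp: image_subset_iff)
  \<comment> \<open>The periodic extension lets windows of steps run past index \<open>k - 1\<close>
    without case distinctions.\<close>
  define x where "x i = int (f (i mod k))" for i
  have xper: "x (i + k) = x i" for i by (simp add: x_def)
  have close: "close_mod (int n) (x j - x i) \<longleftrightarrow>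
      (i + 1) mod k = j mod k \<or> (j + 1) mod k = i mod k" for i j
  proof -
    have "close_mod (int n) (x j - x i) \<longleftrightarrow> {f (i mod k), f (j mod k)} \<in> edges (circulant23 n)"
      using fn by (simp add: edges_circulant23_iff x_def)
    also have "\<dots> \<longleftrightarrow> {i mod k, j mod k} \<in> edges (cycle_graph k)"
      using e k8 by simp
    also have "\<dots> \<longleftrightarrow> (i + 1) mod k = j mod k \<or> (j + 1) mod k = i mod k"
      using k8 by (auto simp: cycle_graph_edge_iff mod_simps)
    finally show ?thesis .
  qed
  define V :: "int set" where "V = {2, 3, -2, -3}"
  \<comment> \<open>The choice depends only on \<open>x i\<close> and \<open>x (i + 1)\<close>, so
    \<open>d\<close> inherits the period.\<close>
  define d where "d i = (SOME s. s \<in> V \<and> int n dvd x (i + 1) - x i - s)" for i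
  have d: "d i \<in> V" "int n dvd x (i + 1) - x i - d i" for i
  proof -
    have "\<exists>s. s \<in> V \<and> int n dvd x (i + 1) - x i - s"
      using close[of "i + 1" i] close[of i "i + 1"] unfolding close_mod_def V_def by blast
    from someI_ex[OF this] show "d i \<in> V" "int n dvd x (i + 1) - x i - d i"
      unfolding d_def by auto
  qed
  have dper: "d (i + k) = d i" for i
    using xper[of i] xper[of "i + 1"] by (simp add: d_def)
  have tele: "int n dvd x (i + l) - x i - (\<Sum>j<l. d (i + j))" for i l
  proof (induction l)
    case (Suc l)
    from dvd_add[OF Suc d(2)[of "i + l"]] show ?case by (simp add: algebra_simps)
  qed simp
  have nonadj: "(\<Sum>j<l. d (i + j)) \<notin> {0, 2, 3, -2, -3}" if l: "2 \<le> l" "l \<le> 4" for i l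
  proof
    let ?s = "\<Sum>j<l. d (i + j)"
    \<comment> \<open>As \<open>k \<ge> 8\<close>, indices 2 to 4 apart are neither equal nor
      consecutive modulo \<open>k\<close>.\<close>
    have *: "(i + l + 1) mod k \<noteq> i mod k" "(i + l) mod k \<noteq> (i + 1) mod k" "(i + l) mod k \<noteq> i mod k"
      using l k8 by (auto simp: mod_eq_dvd_iff_nat dest: dvd_imp_le)
    assume "?s \<in> {0, 2, 3, -2, -3}"
    then consider "?s = 0" | "?s \<in> {2, 3, -2, -3}" by blast
    then show False
    proof cases
      case 1
      with tele[of i l] have "int n dvd x (i + l) - x i" by simp
      moreover have "\<bar>x (i + l) - x i\<bar> < int n"
        using fn[of i] fn[of "i + l"] unfolding x_def by linarith
      ultimately have "x (i + l) = x i" using not_dvd_small[of "x (i + l) - x i" "int n"] by auto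
      then have "f ((i + l) mod k) = f (i mod k)" by (simp add: x_def)
      then have "(i + l) mod k = i mod k" using inj k8 by (auto dest: inj_onD)
      then show False using * by simp
    next
      case 2
      then have "close_mod (int n) (x (i + l) - x i)"
        using tele[of i l] unfolding close_mod_def by blast
      then show False using close[of "i + l" i] * by auto
    qed
  qed
  have sums: "(\<Sum>j<2. d (i + j)) = d i + d (i + 1)"
    "(\<Sum>j<3. d (i + j)) = d i + d (i + 1) + d (i + 2)"
    "(\<Sum>j<4. d (i + j)) = d i + d (i + 1) + d (i + 2) + d (i + 3)" for i
    by (simp_all add: eval_nat_numeral)
  have two: "d i + d (i + 1) \<notin> {0, 2, 3, -2, -3}" for i
    using nonadj[of 2 i] unfolding sums by simp
  have three: "d i + d (i + 1) + d (i + 2) \<notin> {0, 2, 3, -2, -3}" for i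
    using nonadj[of 3 i] unfolding sums by simp
  have four: "d i + d (i + 1) + d (i + 2) + d (i + 3) \<notin> {0, 2, 3, -2, -3}" for i
    using nonadj[of 4 i] unfolding sums by simp
  have vals: "d i \<in> {2, 3, -2, -3}" for i using d(1)[of i] by (simp only: V_def)
  have step: "d (Suc i) + d (Suc i + 1) + d (Suc i + 2) > 0 \<longleftrightarrow> d i + d (i + 1) + d (i + 2) > 0" for i
    using orientation_window[OF vals two three four, of i] by (simp add: numeral_eq_Suc)
  have same: "d i + d (i + 1) + d (i + 2) > 0 \<longleftrightarrow> d 0 + d 1 + d 2 > 0" for i
  proof (induction i)
    case (Suc i)
    then show ?case by (simp only: step)
  qed (simp add: numeral_eq_Suc)
  have total: "int n dvd (\<Sum>i<k. d i)"
    using tele[of 0 k] xper[of 0] by simp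
  show False
  proof (cases "d 0 + d 1 + d 2 > 0")
    case True
    then show False
      using step_sum_ne[OF dper vals two three four _ k m a] same total n by blast
  next
    case False
    \<comment> \<open>Negating the steps reflects the walk by the automorphism \<open>x\<close> to
      \<open>-x\<close> and keeps the order of the indices.\<close>
    let ?d = "\<lambda>i. - d i"
    have neg: "- z \<notin> {0, 2, 3, -2, -3}" if "z \<notin> {0, 2, 3, -2, -3}" for z :: int
      using that by auto
    have "\<not> int (2 * m + 7 * a) dvd (\<Sum>i<k. ?d i)"
    proof (rule step_sum_ne[OF _ _ _ _ _ _ k m a])
      fix i
      show "?d (i + k) = ?d i" by (simp add: dper)
      show "?d i \<in> {2, 3, -2, -3}" using vals[of i] by auto
      show "?d i + ?d (i + 1) \<notin> {0, 2, 3, -2, -3}"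
        using neg[OF two[of i]] by (simp only: minus_add_distrib not_False_eq_True)
      show "?d i + ?d (i + 1) + ?d (i + 2) \<notin> {0, 2, 3, -2, -3}"
        using neg[OF three[of i]] by (simp only: minus_add_distrib not_False_eq_True)
      show "?d i + ?d (i + 1) + ?d (i + 2) + ?d (i + 3) \<notin> {0, 2, 3, -2, -3}"
        using neg[OF four[of i]] by (simp only: minus_add_distrib not_False_eq_True)
      have "\<not> d i + d (i + 1) + d (i + 2) > 0" using False same by blast
      moreover have "d i + d (i + 1) + d (i + 2) \<noteq> 0" using three[of i] by blast
      ultimately show "?d i + ?d (i + 1) + ?d (i + 2) > 0" by linarith
    qed
    then show False using total n by (simp add: sum_negf)
  qed
qed

section \<open>Closed walks with a single chord\<close>

text \<open>One pattern \<open>p\<close> with a single chord from \<open>u\<close> to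
  \<open>v\<close> serves all edges of the same difference: the translation taking
  \<open>p u\<close> to \<open>x\<close> takes \<open>p v\<close> to \<open>y\<close>, so deleting
  \<open>{x, y}\<close> removes exactly the chord.\<close>

lemma has_induced_delete_edgeI:
  fixes p :: "nat \<Rightarrow> int"
  assumes n: "n > 6" and k: "k \<ge> 3" and uv: "u < v" "v < k" "v \<noteq> u + 1" "\<not> (u = 0 \<and> v = k - 1)"
    and range: "\<And>i. i < k \<Longrightarrow> 0 \<le> p i \<and> p i < int n"
    and neq: "\<And>i j. \<lbrakk>i < j; j < k\<rbrakk> \<Longrightarrow> p i \<noteq> p j"
    and adj: "\<And>i j. \<lbrakk>i < j; j < k\<rbrakk> \<Longrightarrow> \<bar>p j - p i\<bar> \<in> {2, 3, int n - 2, int n - 3} \<longleftrightarrow>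
           j = i + 1 \<or> (i = 0 \<and> j = k - 1) \<or> (i = u \<and> j = v)"
    and xy: "x < n" "y < n" "int n dvd int y - int x - (p v - p u)"
  shows "has_induced (delete_edge (circulant23 n) {x, y}) (cycle_graph k)"
proof -
  define f where "f i = nat ((int x - p u + p i) mod int n)" for i
  have intf: "int (f i) = (int x - p u + p i) mod int n" for i
    using n by (simp add: f_def)
  have fn: "f i < n" for i
    using n by (simp add: f_def nat_less_iff)
  have dvd: "int n dvd (int (f j) - int (f i)) - (p j - p i)" for i j
  proof -
    have "int n dvd int (f i) - (int x - p u + p i)" for i
      unfolding intf by (simp flip: mod_eq_dvd_iff)
    from dvd_diff[OF this[of j] this[of i]] show ?thesis by (simp add: algebra_simps)
  qed
  have small: "\<bar>p j - p i\<bar> < int n" if "i < k" "j < k" for i j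
    using range[OF that(1)] range[OF that(2)] by linarith
  have close: "close_mod (int n) (int (f j) - int (f i)) \<longleftrightarrow> \<bar>p j - p i\<bar> \<in> {2, 3, int n - 2, int n - 3}"
    if "i < k" "j < k" for i j
    using close_mod_cong[OF dvd] close_mod_iff[OF small[OF that]] n by simp
  have fneq: "f i \<noteq> f j" if "i < j" "j < k" for i j
  proof
    assume "f i = f j"
    then have "int n dvd p j - p i" using dvd[of j i] dvd_minus_iff[of "int n" "p j - p i"] by simp
    then show False
      using not_dvd_small[OF _ small[of i j]] neq[OF that] that by auto
  qed
  have inj: "inj_on f {..<k}"
    by (rule linorder_inj_onI) (use fneq in auto)
  have fu: "f u = x" using xy(1) by (simp add: f_def)
  have "int n dvd int (f v) - int y"
    using dvd_diff[OF dvd[of v u] xy(3)] fu by simp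
  then have "int (f v) - int y = 0"
    using not_dvd_small[of "int (f v) - int y" "int n"] fn[of v] xy(2) by linarith
  then have fv: "f v = y" by simp
  have lt: "{f i, f j} \<in> edges (delete_edge (circulant23 n) {x, y}) \<longleftrightarrow>
      {i, j} \<in> edges (cycle_graph k)" if ij: "i < j" "j < k" for i j
  proof -
    have "{f i, f j} = {x, y} \<longleftrightarrow> i = u \<and> j = v"
      using inj ij uv unfolding fu[symmetric] fv[symmetric]
      by (auto simp: doubleton_eq_iff inj_on_eq_iff)
    moreover have "{i, j} \<in> edges (cycle_graph k) \<longleftrightarrow> j = i + 1 \<or> (i = 0 \<and> j = k - 1)"
    proof (cases "j + 1 = k")
      case True
      then show ?thesis using ij by (auto simp: cycle_graph_edge_iff)
    qed (use ij in \<open>auto simp: cycle_graph_edge_iff\<close>)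
    ultimately show ?thesis
      using close[of i j] adj[OF ij] ij uv fn
      by (auto simp: delete_edge_def edges_circulant23_iff)
  qed
  show ?thesis
  proof (rule has_inducedI[OF inj])
    show "f ` {..<k} \<subseteq> verts (delete_edge (circulant23 n) {x, y})"
      using fn by (auto simp: delete_edge_def)
    show "{f i, f j} \<in> edges (delete_edge (circulant23 n) {x, y}) \<longleftrightarrow>
        {i, j} \<in> edges (cycle_graph k)" if "i < k" "j < k" for i j
    proof (cases i j rule: linorder_cases)
      case equal
      have "{f i, f i} \<notin> edges (circulant23 n)"
        using n not_close_mod_zero[of "int n"] by (simp only: edges_circulant23_iff) simp
      moreover have "{i, i} \<notin> edges (cycle_graph k)"
        using that k by (simp only: cycle_graph_edge_iff) (cases "i + 1 = k"; simp)
      ultimately show ?thesis using equal by (simp add: delete_edge_def)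
    next
      case greater
      then show ?thesis using lt[of j i] that by (simp add: insert_commute)
    qed (use lt that in simp)
  qed
qed


text \<open>The partial sums of the periodic step sequence \<open>3, -2, 3, 3, \<dots>\<close>.\<close>

definition zigzag :: "nat \<Rightarrow> int" where
  "zigzag i = 7 * int (i div 4) + [0, 3, 1, 4] ! (i mod 4)"

lemma zigzag_cases:
  obtains b where "i = 4 * b" "zigzag i = 7 * int b"
  | b where "i = 4 * b + 1" "zigzag i = 7 * int b + 3"
  | b where "i = 4 * b + 2" "zigzag i = 7 * int b + 1"
  | b where "i = 4 * b + 3" "zigzag i = 7 * int b + 4"
proof -
  define b r where "b = i div 4" and "r = i mod 4"
  have i: "i = 4 * b + r" by (simp add: b_def r_def)
  have z: "zigzag i = 7 * int b + [0, 3, 1, 4] ! r" by (simp add: zigzag_def b_def r_def)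
  have "r = 0 \<or> r = 1 \<or> r = 2 \<or> r = 3" unfolding r_def by linarith
  then show thesis using that[of b] i z by auto
qed

lemma zigzag_bounds:
  assumes "i < 4 * a"
  shows "0 \<le> zigzag i" "zigzag i \<le> 7 * int a - 3"
proof -
  have lt: "int b + 1 \<le> int a" if "4 * b \<le> i" for b using assms that by linarith
  have "0 \<le> zigzag i \<and> zigzag i \<le> 7 * int a - 3"
  proof (cases i rule: zigzag_cases)
    case (1 b)
    then show ?thesis using lt[of b] by linarith
  next
    case (2 b)
    then show ?thesis using lt[of b] by linarith
  next
    case (3 b)
    then show ?thesis using lt[of b] by linarith
  next
    case (4 b)
    then show ?thesis using lt[of b] by linarith
  qed
  then show "0 \<le> zigzag i" "zigzag i \<le> 7 * int a - 3" by auto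
qed

text \<open>The same or neighbouring blocks leave finitely many cases; from two blocks apart the
  difference is at least \<open>14 - 4\<close>. So differences 2 and 3 in absolute value occur only
  at consecutive indices.\<close>

lemma zigzag_diff:
  assumes "i < j"
  shows "j = i + 1 \<and> (zigzag j - zigzag i = 3 \<or> zigzag j - zigzag i = -2) \<or>
    i + 2 \<le> j \<and> (zigzag j - zigzag i = 1 \<or> zigzag j - zigzag i \<ge> 4)"
proof -
  have form: "\<exists>b. i = 4 * b \<and> zigzag i = 7 * int b \<or> i = 4 * b + 1 \<and> zigzag i = 7 * int b + 3 \<or>
      i = 4 * b + 2 \<and> zigzag i = 7 * int b + 1 \<or> i = 4 * b + 3 \<and> zigzag i = 7 * int b + 4" for i
    by (rule zigzag_cases[of i]) blast+
  from form[of i] obtain b where b: "i = 4 * b \<and> zigzag i = 7 * int b \<or>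
      i = 4 * b + 1 \<and> zigzag i = 7 * int b + 3 \<or> i = 4 * b + 2 \<and> zigzag i = 7 * int b + 1 \<or>
      i = 4 * b + 3 \<and> zigzag i = 7 * int b + 4" ..
  from form[of j] obtain b' where b': "j = 4 * b' \<and> zigzag j = 7 * int b' \<or>
      j = 4 * b' + 1 \<and> zigzag j = 7 * int b' + 3 \<or> j = 4 * b' + 2 \<and> zigzag j = 7 * int b' + 1 \<or>
      j = 4 * b' + 3 \<and> zigzag j = 7 * int b' + 4" ..
  define P Q where "P = zigzag i" and "Q = zigzag j"
  note bb = b[folded P_def] b'[folded Q_def]
  have "b \<le> b'" using assms bb by linarith
  then consider "b' = b" | "b' = b + 1" | "b + 2 \<le> b'" by linarith
  then show ?thesis
    unfolding P_def[symmetric] Q_def[symmetric]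
  proof cases
    case 1
    show "j = i + 1 \<and> (Q - P = 3 \<or> Q - P = -2) \<or> i + 2 \<le> j \<and> (Q - P = 1 \<or> Q - P \<ge> 4)"
      using bb assms unfolding 1 by (elim disjE conjE; simp)
  next
    case 2
    show "j = i + 1 \<and> (Q - P = 3 \<or> Q - P = -2) \<or> i + 2 \<le> j \<and> (Q - P = 1 \<or> Q - P \<ge> 4)"
      using bb unfolding 2 by (elim disjE conjE; simp)
  next
    case 3
    then have "i + 2 \<le> j" "Q - P \<ge> 4" using bb by linarith+
    then show "j = i + 1 \<and> (Q - P = 3 \<or> Q - P = -2) \<or> i + 2 \<le> j \<and> (Q - P = 1 \<or> Q - P \<ge> 4)"
      by simp
  qed
qed

lemma inj_zigzag: "inj zigzag"
  by (rule linorder_injI) (use zigzag_diff in force)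

text \<open>By injectivity it suffices to evaluate \<open>zigzag\<close> at each residue modulo 4.
  The equivalences translate conditions on positions into conditions on indices.\<close>

lemma zigzag_eq_iff:
  "zigzag i = 7 * int b \<longleftrightarrow> i = 4 * b"
  "zigzag i = 7 * int b + 1 \<longleftrightarrow> i = 4 * b + 2"
  "zigzag i = 7 * int b + 3 \<longleftrightarrow> i = 4 * b + 1"
  "zigzag i = 7 * int b + 4 \<longleftrightarrow> i = 4 * b + 3"
proof -
  have "zigzag (4 * b) = 7 * int b" "zigzag (4 * b + 2) = 7 * int b + 1"
    "zigzag (4 * b + 1) = 7 * int b + 3" "zigzag (4 * b + 3) = 7 * int b + 4"
    by (simp_all add: zigzag_def div_mult_self4 mod_mult_self4 del: add_2_eq_Suc')
  then show "zigzag i = 7 * int b \<longleftrightarrow> i = 4 * b" "zigzag i = 7 * int b + 1 \<longleftrightarrow> i = 4 * b + 2"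
    "zigzag i = 7 * int b + 3 \<longleftrightarrow> i = 4 * b + 1" "zigzag i = 7 * int b + 4 \<longleftrightarrow> i = 4 * b + 3"
    by (metis injD inj_zigzag)+
qed

text \<open>The values are 0, 1, 3, 4 modulo 7. This rules out a second chord, of difference 3, at
  position \<open>7 * int c + 5\<close> of the walk for difference 2.\<close>

lemma zigzag_ne: "zigzag i \<noteq> 7 * int b + 2"
  by (rule zigzag_cases[of i]) (simp_all, presburger+)

text \<open>The walk is \<open>a\<close> blocks followed by \<open>m\<close> steps 2, started at 0.
  Its chord joins position 1 at index 2 to position \<open>n - 2\<close> at index
  \<open>k - 1\<close>; the difference \<open>n - 3\<close> is -3 modulo \<open>n\<close>.\<close>

lemma has_induced_delete_edge_diff_3:
  assumes k: "k = m + 4 * a" and m: "m = 2 \<or> m = 4" and a: "a \<ge> 1" and k8: "k \<ge> 8"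
    and n: "n = 2 * m + 7 * a"
    and xy: "x < n" "y < n" "int n dvd int y - int x - (-3)"
  shows "has_induced (delete_edge (circulant23 n) {x, y}) (cycle_graph k)"
proof -
  define p where "p i = (if i < 4 * a then zigzag i else 7 * int a + 2 * (int i - 4 * int a))" for i
  have p2: "p 2 = 1" using a by (simp add: p_def zigzag_def)
  have pk: "p (k - 1) = int n - 2" using k n m by (auto simp: p_def)
  have adj: "p i \<noteq> p j \<and> (\<bar>p j - p i\<bar> \<in> {2, 3, int n - 2, int n - 3} \<longleftrightarrow>
       j = i + 1 \<or> (i = 0 \<and> j = k - 1) \<or> (i = 2 \<and> j = k - 1))" if ij: "i < j" "j < k" for i j
  proof -
    consider "j < 4 * a" | "i < 4 * a" "4 * a \<le> j" | "4 * a \<le> i" using ij by linarith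
    then show ?thesis
    proof cases
      case 1
      then have i: "i < 4 * a" using ij by simp
      define D where "D = zigzag j - zigzag i"
      have "j \<noteq> k - 1" using 1 k m by auto
      moreover have "\<bar>D\<bar> < int n - 3"
        using zigzag_bounds[OF 1] zigzag_bounds[OF i] n m unfolding D_def by linarith
      moreover have "D \<noteq> 0 \<and> (\<bar>D\<bar> = 2 \<or> \<bar>D\<bar> = 3 \<longleftrightarrow> j = i + 1)"
        using zigzag_diff[OF ij(1), folded D_def] by (elim disjE conjE) simp_all
      ultimately show ?thesis using 1 i by (auto simp: p_def D_def)
    next
      case 2
      from 2(2) obtain r where r: "j = 4 * a + r" using le_Suc_ex by blast
      define D where "D = 7 * int a + 2 * int r - zigzag i"
      have D: "p j - p i = D" using 2 r by (simp add: p_def D_def)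
      have "r < m" using r ij k by simp
      note bounds = zigzag_bounds[OF 2(1)] this
      obtain a' where a': "a = Suc a'" using a by (cases a) auto
      have "7 * int a - 3 = 7 * int a' + 4" "4 * a - 1 = 4 * a' + 3" by (simp_all add: a')
      then have last: "i = 4 * a - 1 \<longleftrightarrow> zigzag i = 7 * int a - 3"
        using zigzag_eq_iff(4)[of i a'] by (simp only:)
      have first: "i = 0 \<longleftrightarrow> zigzag i = 0" "i = 2 \<longleftrightarrow> zigzag i = 1"
        using zigzag_eq_iff(1,2)[of i 0] by auto
      have k1: "j = k - 1 \<longleftrightarrow> int r = int m - 1" using r k m by auto
      have i1: "j = i + 1 \<longleftrightarrow> int r = 0 \<and> i = 4 * a - 1" using r 2 a by auto
      have "D \<ge> 3" using bounds by (simp add: D_def)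
      moreover have "D = 3 \<longleftrightarrow> int r = 0 \<and> zigzag i = 7 * int a - 3"
        using bounds unfolding D_def by linarith
      moreover have "D = int n - 2 \<longleftrightarrow> zigzag i = 0 \<and> int r = int m - 1"
        using bounds n unfolding D_def by linarith
      moreover have "D = int n - 3 \<longleftrightarrow> zigzag i = 1 \<and> int r = int m - 1"
        using bounds n unfolding D_def by presburger
      moreover have "p i \<noteq> p j" using D \<open>D \<ge> 3\<close> by auto
      ultimately show ?thesis unfolding k1 i1 last first D by auto
    next
      case 3
      then have "p j - p i = 2 * (int j - int i)" using ij by (simp add: p_def)
      moreover have "i \<noteq> 0" "i \<noteq> 2" "2 * (int j - int i) < int n - 3" using 3 a ij k n m by auto
      ultimately show ?thesis using ij by auto
    qed
  qed
  show ?thesis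
  proof (rule has_induced_delete_edgeI[of n k 2 "k - 1" p])
    show "int n dvd int y - int x - (p (k - 1) - p 2)"
      unfolding pk p2 using dvd_diff[OF xy(3), of "int n"] by (simp add: algebra_simps)
    show "0 \<le> p i \<and> p i < int n" if "i < k" for i
      using zigzag_bounds[of i a] that k n m by (auto simp: p_def)
  qed (use adj n m a k k8 xy in auto)
qed

text \<open>Here \<open>a = c + 2\<close>. One block loses its last 3, which moves to the end of the
  walk as the closing step. This brings the last block closer, so that \<open>7 * int c + 3\<close>
  and \<open>7 * int c + 5\<close> form the chord.\<close>

lemma has_induced_delete_edge_diff_2:
  assumes k: "k = m + 4 * c + 8" and m: "m = 2 \<or> m = 4"
    and n: "n = 2 * m + 7 * c + 14"
    and xy: "x < n" "y < n" "int n dvd int y - int x - 2"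
  shows "has_induced (delete_edge (circulant23 n) {x, y}) (cycle_graph k)"
proof -
  \<comment> \<open>Offsets from \<open>7 * int c\<close> after the shortened block: 7, 5, 8, 11
    come from the last block, then steps 2 follow; 17 and 19 belong to \<open>m = 4\<close>. The
    last position is \<open>n - 3\<close>, one step 3 before closing.\<close>
  define E where "E = [7, 5, 8, 11, 13, 15, 17, 19 :: int]"
  define p where "p i = (if i < 4 * Suc c then zigzag i else 7 * int c + E ! (i - 4 * Suc c))" for i
  have tail: "p (4 * Suc c + r) = 7 * int c + E ! r" for r by (simp add: p_def)
  have E: "r = 0 \<and> E ! r = 7 \<or> r = 1 \<and> E ! r = 5 \<or> r = 2 \<and> E ! r = 8 \<or> r = 3 \<and> E ! r = 11 \<or>
      r = 4 \<and> E ! r = 13 \<or> r = 5 \<and> E ! r = 15 \<or>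
      m = 4 \<and> (r = 6 \<and> E ! r = 17 \<or> r = 7 \<and> E ! r = 19)" if "r < m + 4" for r
  proof -
    have "r = 0 \<or> r = 1 \<or> r = 2 \<or> r = 3 \<or> r = 4 \<or> r = 5 \<or> m = 4 \<and> (r = 6 \<or> r = 7)"
      using that m by auto
    then show ?thesis by (elim disjE conjE; simp add: E_def)
  qed
  have pu: "p (4 * c + 1) = 7 * int c + 3"
    using zigzag_eq_iff(3)[of "4 * c + 1" c] by (simp add: p_def)
  have pv: "p (4 * c + 5) = 7 * int c + 5"
    using tail[of 1] by (simp add: E_def add.commute)
  have adj: "p i \<noteq> p j \<and> (\<bar>p j - p i\<bar> \<in> {2, 3, int n - 2, int n - 3} \<longleftrightarrow>
       j = i + 1 \<or> (i = 0 \<and> j = k - 1) \<or> (i = 4 * c + 1 \<and> j = 4 * c + 5))"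
    if ij: "i < j" "j < k" for i j
  proof -
    consider "j < 4 * Suc c" | "i < 4 * Suc c" "4 * Suc c \<le> j" | "4 * Suc c \<le> i" using ij by linarith
    then show ?thesis
    proof cases
      case 1
      then have i: "i < 4 * Suc c" using ij by simp
      define D where "D = zigzag j - zigzag i"
      have "j \<noteq> k - 1" "j \<noteq> 4 * c + 5" using 1 k by auto
      moreover have "\<bar>D\<bar> < int n - 3"
        using zigzag_bounds[OF 1] zigzag_bounds[OF i] n unfolding D_def by simp
      moreover have "D \<noteq> 0 \<and> (\<bar>D\<bar> = 2 \<or> \<bar>D\<bar> = 3 \<longleftrightarrow> j = i + 1)"
        using zigzag_diff[OF ij(1), folded D_def] by (elim disjE conjE) simp_all
      ultimately show ?thesis using 1 i by (auto simp: p_def D_def)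
    next
      case 2
      from 2(2) obtain r where r: "j = 4 * Suc c + r" using le_Suc_ex by blast
      have "r < m + 4" using r ij k by simp
      note e = E[OF this]
      define D where "D = 7 * int c + E ! r - zigzag i"
      have D: "p j - p i = D" using 2(1) unfolding r tail D_def by (simp add: p_def)
      note bounds = zigzag_bounds[OF 2(1), unfolded of_nat_Suc] zigzag_ne[of i c]
      have k1: "j = k - 1 \<longleftrightarrow> r = m + 3" using r k m by auto
      have i1: "j = i + 1 \<longleftrightarrow> r = 0 \<and> i = 4 * c + 3" using r 2 by auto
      have v1: "j = 4 * c + 5 \<longleftrightarrow> r = 1" using r by auto
      have first: "i = 0 \<longleftrightarrow> zigzag i = 0" using zigzag_eq_iff(1)[of i 0] by auto
      have "D \<ge> 1" using bounds(2) e by (auto simp: D_def)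
      moreover have "D = 2 \<longleftrightarrow> zigzag i = 7 * int c + 3 \<and> r = 1"
        using bounds(2) e unfolding D_def by (elim disjE conjE; simp; linarith)
      moreover have "D = 3 \<longleftrightarrow> r = 0 \<and> zigzag i = 7 * int c + 4"
        using bounds(2,3) e unfolding D_def by (elim disjE conjE; simp; linarith)
      moreover have "D \<noteq> int n - 2"
        using bounds(1) e m n unfolding D_def by (elim disjE conjE; simp)
      moreover have "D = int n - 3 \<longleftrightarrow> zigzag i = 0 \<and> r = m + 3"
        using bounds(1) e m n unfolding D_def by (elim disjE conjE; simp)
      moreover have "p i \<noteq> p j" using D \<open>D \<ge> 1\<close> by auto
      ultimately show ?thesis
        unfolding k1 i1 v1 first zigzag_eq_iff(3,4)[of i c, symmetric] D by auto
    next
      case 3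
      then obtain r where r: "i = 4 * Suc c + r" using le_Suc_ex by blast
      from 3 ij obtain r' where r': "j = 4 * Suc c + r'" by (meson le_Suc_ex le_trans less_imp_le)
      have "r < m + 4" "r' < m + 4" "r < r'" using r r' ij k by auto
      have idx: "j = i + 1 \<longleftrightarrow> r' = r + 1" "i \<noteq> 0" "i \<noteq> 4 * c + 1" using r r' by auto
      have "E ! r \<noteq> E ! r' \<and> (\<bar>E ! r' - E ! r\<bar> \<in> {2, 3, int n - 2, int n - 3} \<longleftrightarrow> r' = r + 1)"
        using E[OF \<open>r < m + 4\<close>] E[OF \<open>r' < m + 4\<close>] \<open>r < r'\<close> m n by (elim disjE conjE; simp)
      then show ?thesis using idx unfolding r r' tail by simp
    qed
  qed
  show ?thesis
  proof (rule has_induced_delete_edgeI[of n k "4 * c + 1" "4 * c + 5" p])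
    show "int n dvd int y - int x - (p (4 * c + 5) - p (4 * c + 1))"
      unfolding pv pu using xy(3) by simp
    show "0 \<le> p i \<and> p i < int n" if "i < k" for i
    proof (cases "i < 4 * Suc c")
      case True
      then show ?thesis using zigzag_bounds[OF True] n by (simp add: p_def)
    next
      case False
      then obtain r where r: "i = 4 * Suc c + r" by (metis le_Suc_ex not_less)
      then have "r < m + 4" using that k by simp
      from E[OF this] show ?thesis unfolding r tail using n m by auto
    qed
  qed (use adj n m k xy in auto)
qed

text \<open>For \<open>n = 15\<close>, \<open>k = 8\<close> the only suitable closed walk does not wind around: it bounds two
  pentagons glued along an edge.\<close>

lemma has_induced_delete_edge_diff_2_of_15:
  assumes xy: "x < 15" "y < 15" "15 dvd int y - int x - 2"
  shows "has_induced (delete_edge (circulant23 15) {x, y}) (cycle_graph 8)"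
proof -
  \<comment> \<open>The pentagons are 0, 3, 6, 4, 2 and 0, 2, 14, 11, 13, sharing the chord from 0
    to 2.\<close>
  define p where "p i = [0, 3, 6, 4, 2, 14, 11, 13 :: int] ! i" for i
  have all8: "(\<forall>i<8. P i) \<longleftrightarrow> P 0 \<and> P 1 \<and> P 2 \<and> P 3 \<and> P 4 \<and> P 5 \<and> P 6 \<and> P (7 :: nat)" for P
    by (simp add: numeral_eq_Suc All_less_Suc conj_ac)
  have p: "p 0 = 0" "p 1 = 3" "p 2 = 6" "p 3 = 4" "p 4 = 2" "p 5 = 14" "p 6 = 11" "p 7 = 13"
    by (simp_all add: p_def)
  have adj: "\<forall>j<8. \<forall>i<8. i < j \<longrightarrow> p i \<noteq> p j \<and> (\<bar>p j - p i\<bar> \<in> {2, 3, int 15 - 2, int 15 - 3} \<longleftrightarrow>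
           j = i + 1 \<or> (i = 0 \<and> j = 8 - 1) \<or> (i = 0 \<and> j = 4))"
    unfolding all8 p by simp
  have range: "\<forall>i<8. 0 \<le> p i \<and> p i < int 15"
    unfolding all8 p by simp
  show ?thesis
  proof (rule has_induced_delete_edgeI[of 15 8 0 4 p])
    show "int 15 dvd int y - int x - (p 4 - p 0)" using xy(3) by (simp add: p)
    show "0 \<le> p i \<and> p i < int 15" if "i < 8" for i using range that by blast
    fix i j :: nat assume ij: "i < j" "j < 8"
    then have "i < 8" by simp
    then show "p i \<noteq> p j" using adj ij by blast
    show "\<bar>p j - p i\<bar> \<in> {2, 3, int 15 - 2, int 15 - 3} \<longleftrightarrow>
           j = i + 1 \<or> (i = 0 \<and> j = 8 - 1) \<or> (i = 0 \<and> j = 4)"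
      using adj[rule_format, of j i] ij \<open>i < 8\<close> by blast
  qed (use xy in simp_all)
qed

section \<open>Parameters for a given \<open>t\<close>\<close>

theorem theorem1p6:
  fixes t :: nat
  assumes "t \<ge> 5"
  shows "\<exists>G :: nat graph. finite_simple_graph G \<and> edges G \<noteq> {} \<and>
           induced_free (cycle_graph (2 * t - 2)) G \<and>
           (\<forall>e\<in>edges G. has_induced (delete_edge G e) (cycle_graph (2 * t - 2)))"
proof -
  define k where "k = 2 * t - 2"
  \<comment> \<open>\<open>m\<close> is the representative of \<open>k\<close> modulo 4 in
    \<open>{2, 4}\<close>.\<close>
  define m a where "m = (if even t then 2 else 4 :: nat)" and "a = (k - m) div 4"
  define n where "n = 2 * m + 7 * a"
  have m: "m = 2 \<or> m = 4" by (simp add: m_def)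
  have k8: "k \<ge> 8" using assms by (simp add: k_def)
  have k: "k = m + 4 * a"
    using assms unfolding k_def m_def a_def by (auto elim!: evenE oddE)
  have a: "a \<ge> 1" using k k8 m by auto
  have n6: "n > 6" using a m by (auto simp: n_def)
  have crit: "has_induced (delete_edge (circulant23 n) {x, y}) (cycle_graph k)"
    if xy: "x < n" "y < n" "int n dvd int y - int x - s" "s = 2 \<or> s = -3" for x y s
  proof (cases "s = 2")
    case False
    then show ?thesis using has_induced_delete_edge_diff_3[OF k m a k8 n_def] xy by auto
  next
    case True
    show ?thesis
    proof (cases "a = 1")
      case a1: True
      \<comment> \<open>The value \<open>m = 2\<close> would give \<open>k = 6\<close>.\<close>
      then have "m = 4" using k8 k m by auto
      then show ?thesis using has_induced_delete_edge_diff_2_of_15[of x y] xy True a1 k by (simp add: n_def)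
    next
      case False
      then have "a \<ge> 2" using a by simp
      then obtain c where "a = c + 2" by (metis add.commute le_Suc_ex)
      then show ?thesis
        using has_induced_delete_edge_diff_2[of k m c n x y] k m xy True by (simp add: n_def)
    qed
  qed
  have "has_induced (delete_edge (circulant23 n) e) (cycle_graph k)"
    if "e \<in> edges (circulant23 n)" for e
  proof -
    from that obtain x y where e: "e = {x, y}" "x < n" "y < n"
      and "close_mod (int n) (int y - int x)"
      by (auto simp: circulant23_def)
    then obtain s where s: "s \<in> {2, 3, -2, -3}" "int n dvd int y - int x - s"
      unfolding close_mod_def by blast
    \<comment> \<open>Swapping the ends negates the difference, so 2 and -3 cover all four.\<close>
    then have "int n dvd int x - int y - (- s)"
      using dvd_minus_iff[of "int n" "int y - int x - s"] by (simp add: algebra_simps)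
    then show ?thesis
      using crit[of x y s] crit[of y x "- s"] s e by (auto simp: insert_commute)
  qed
  moreover have "{0, 2} \<in> edges (circulant23 n)"
    using n6 by (simp add: edges_circulant23_iff close_mod_iff)
  ultimately show ?thesis
    using finite_simple_circulant23[OF n6] circulant23_induced_free[OF k m a k8 n_def]
    unfolding k_def[symmetric] by blast
qed

end
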